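(* Let $P(\boldsymbol{Y})\in\mathbb{Z}[\boldsymbol{Y}]$ be a non-constant homogeneous polynomial in $d$ variables $\boldsymbol{Y}=(Y_1,\dots,Y_d)$. If $P$ is factor-wise regular, then, as $N\to\infty$, $$\sum_{\substack{\boldsymbol{n}\in\mathbb{N}^d,\ \max\{\boldsymbol{n}\}\le N\\ \gcd(\boldsymbol{n})=1}} \Omega(|P(\boldsymbol{n})|)\ \ll_{P}\ N^d\log\log N .$$
   Context: $\mathbb{N}$ denotes the positive integers. For $n\in\mathbb{N}$, $\Omega(n)$ is the total number of prime factors of $n$ counted with multiplicity, and $\Omega(0)=0$. For $\boldsymbol{n}=(n_1,\dots,n_d)\in\mathbb{N}^d$, $\max\{\boldsymbol{n}\}=\max(n_1,\dots,n_d)$ and $\gcd(\boldsymbol{n})=\gcd(n_1,\dots,n_d)$. The notation $A\ll_P B$ means $|A|\le C B$ for all sufficiently large $N$, with a constant $C$ depending only on $P$. Definition (factor-wise regular). Write $P(\boldsymbol{Y})=c\prod_{j=1}^{r}P_j(\boldsymbol{Y})^{e_j}$, where $r,e_j\in\mathbb{N}$, $c\in\mathbb{Z}\setminus\{0\}$, and the $P_j\in\mathbb{Z}[\boldsymbol{Y}]$ are distinct primitive irreducible homogeneous polynomials. $P$ is called factor-wise regular if each projective hypersurface $P_j(\boldsymbol{Y})=0$ (in $\mathbf{P}_{d-1}$) is smooth over $\mathbb{Q}$. *)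

theory Defs
  imports
    "HOL-Library.Poly_Mapping"
    "HOL-Library.FuncSet"
    "HOL-Library.Landau_Symbols"
    "HOL-Computational_Algebra.Computational_Algebra"
begin

text \<open>
  A monomial maps each variable index to its exponent, and a polynomial maps each monomial to its
  coefficient. The ring has countably many variables \<open>Y\<^sub>0, Y\<^sub>1, \<dots>\<close>; polynomials in \<open>d\<close> variables are
  those in which only \<open>Y\<^sub>i\<close> with \<open>i < d\<close> occur. This subring contains all the units (\<open>1\<close> and \<open>-1\<close>) and
  all the divisors of its nonzero elements, so irreducibility in it and in the big ring agree.
\<close>

type_synonym monomial = "nat \<Rightarrow>\<^sub>0 nat"
type_synonym int_mpoly = "monomial \<Rightarrow>\<^sub>0 int"

definition in_vars :: "nat \<Rightarrow> int_mpoly \<Rightarrow> bool" where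
  "in_vars d P \<longleftrightarrow> (\<forall>m\<in>Poly_Mapping.keys P. Poly_Mapping.keys m \<subseteq> {..<d})"

definition nonconstant_mpoly :: "int_mpoly \<Rightarrow> bool" where
  "nonconstant_mpoly P \<longleftrightarrow> (\<nexists>c. P = Poly_Mapping.single 0 c)"

definition monomial_degree :: "monomial \<Rightarrow> nat" where
  "monomial_degree m = (\<Sum>i\<in>Poly_Mapping.keys m. Poly_Mapping.lookup m i)"

definition homogeneous_mpoly :: "int_mpoly \<Rightarrow> bool" where
  "homogeneous_mpoly P \<longleftrightarrow> (\<exists>k. \<forall>m\<in>Poly_Mapping.keys P. monomial_degree m = k)"

definition primitive_mpoly :: "int_mpoly \<Rightarrow> bool" where
  "primitive_mpoly P \<longleftrightarrow> Gcd (Poly_Mapping.lookup P ` Poly_Mapping.keys P) = 1"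

definition eval_mpoly :: "int_mpoly \<Rightarrow> (nat \<Rightarrow> 'a::comm_ring_1) \<Rightarrow> 'a" where
  "eval_mpoly P x =
     (\<Sum>m\<in>Poly_Mapping.keys P.
        of_int (Poly_Mapping.lookup P m) *
        (\<Prod>i\<in>Poly_Mapping.keys m. x i ^ Poly_Mapping.lookup m i))"

text \<open>
  The truncated exponent \<open>0 - 1 = 0\<close> is harmless: it only occurs with the coefficient \<open>0\<close>.
\<close>

definition partial_deriv :: "nat \<Rightarrow> int_mpoly \<Rightarrow> int_mpoly" where
  "partial_deriv i P =
     (\<Sum>m\<in>Poly_Mapping.keys P. Poly_Mapping.single (m - Poly_Mapping.single i 1)
                                     (Poly_Mapping.lookup P m * int (Poly_Mapping.lookup m i)))"

text \<open>
  Smoothness over \<open>\<rat>\<close> of the hypersurface \<open>Q = 0\<close> in \<open>\<bbbP>\<^sub>d\<^sub>-\<^sub>1\<close> by the Jacobian criterion: no geometric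
  point of the hypersurface is a common zero of all the partial derivatives. The points are taken
  over the algebraically closed field \<open>\<complex>\<close> and given by homogeneous coordinates. Rational points
  alone would not suffice.
\<close>

definition smooth_hypersurface :: "nat \<Rightarrow> int_mpoly \<Rightarrow> bool" where
  "smooth_hypersurface d Q \<longleftrightarrow>
     (\<forall>z :: nat \<Rightarrow> complex.
        (\<exists>i<d. z i \<noteq> 0) \<and> eval_mpoly Q z = 0 \<longrightarrow>
        (\<exists>i<d. eval_mpoly (partial_deriv i Q) z \<noteq> 0))"

definition factorwise_regular :: "nat \<Rightarrow> int_mpoly \<Rightarrow> bool" where
  "factorwise_regular d P \<longleftrightarrow>
     (\<exists>(c::int) (r::nat) (Q :: nat \<Rightarrow> int_mpoly) (e :: nat \<Rightarrow> nat).
        c \<noteq> 0 \<and> r \<ge> 1 \<and> inj_on Q {1..r} \<and>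
        (\<forall>j\<in>{1..r}. e j \<ge> 1 \<and> in_vars d (Q j) \<and> homogeneous_mpoly (Q j) \<and>
                    primitive_mpoly (Q j) \<and> irreducible (Q j) \<and> smooth_hypersurface d (Q j)) \<and>
        P = Poly_Mapping.single 0 c * (\<Prod>j=1..r. Q j ^ e j))"

text \<open>
  Since \<^term>\<open>prime_factorization (0::nat) = {#}\<close>, this gives \<open>0\<close> at \<open>0\<close>.
\<close>

definition big_omega :: "nat \<Rightarrow> nat" where
  "big_omega n = size (prime_factorization n)"

text \<open>
  Tuples of \<open>d\<close> positive integers are extensional functions on \<open>{..<d}\<close>.
\<close>

definition primitive_tuples :: "nat \<Rightarrow> nat \<Rightarrow> (nat \<Rightarrow> nat) set" where
  "primitive_tuples d N = {n \<in> {..<d} \<rightarrow>\<^sub>E {1..N}. Gcd (n ` {..<d}) = 1}"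

end

theory Submission
  imports Defs "HOL-Analysis.Harmonic_Numbers" "HOL-Library.Discrete_Functions"
begin

text \<open>
  Let \<open>P\<close> be homogeneous of degree \<open>k \<ge> 1\<close>. A nonzero polynomial does not vanish at all points with
  natural coordinates, so there is a direction \<open>v\<close> with \<open>A = P(v) \<noteq> 0\<close>. On every line \<open>m + t v\<close> with
  integral \<open>m\<close>, \<open>P\<close> restricts to an integer polynomial \<open>f(t) = P(m + t v)\<close> of degree at most \<open>k\<close>
  whose coefficient of \<open>t\<^sup>k\<close> is the same \<open>A\<close> for all lines (\<open>eval_mpoly_line\<close>). This makes every
  bound on \<open>f\<close> in terms of \<open>k\<close> and \<open>A\<close> uniform in \<open>m\<close>.

  The decisive bound is the following. If \<open>k + 1\<close> integers, pairwise incongruent modulo \<open>p ^ (b + 1)\<close>,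
  are roots of \<open>f\<close> modulo \<open>p ^ a\<close>, then dividing off one root after the other loses at most \<open>p ^ b\<close>
  each time, so that \<open>p ^ a\<close> divides \<open>p ^ (k b) A\<close> (\<open>prime_power_dvd_leading_coeff\<close>). Hence the roots
  modulo \<open>p ^ a\<close> lie in at most \<open>k\<close> residue classes modulo \<open>p ^ (b + 1)\<close>, where
  \<open>b = (a - 1 - v\<^sub>p(A)) div k\<close>. Their density is therefore \<open>O(1/p)\<close> for the first \<open>k\<close> exponents
  above \<open>v\<^sub>p(A)\<close>, and gains a factor \<open>1/p\<close> after every further \<open>k\<close> exponents. Summed over all
  \<open>p ^ a \<le> N\<close> this gives \<open>N (v\<^sub>p(A) + O(1/p))\<close> for the \<open>N\<close> values \<open>0 \<le> t < N\<close>; summed over \<open>p \<le> N\<close>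
  it gives \<open>O(N (1 + \<Sum> 1/p)) = O(N log log N)\<close>, by the upper bound in Mertens' second theorem.

  Two reductions connect this with the sum in question. Since \<open>|P(n)| = O(N ^ k)\<close>, the number
  \<open>\<Omega>(|P(n)|)\<close> is bounded by a constant multiple of the number of prime powers \<open>p ^ a \<le> N\<close> that
  divide \<open>P(n)\<close>, plus a constant (\<open>big_omega_le\<close>). The sum of a nonnegative function over the box
  \<open>[1, N]\<^sup>d\<close> is at most \<open>1 / N\<close> times the total of its sums over the segments
  \<open>{m + t v | 0 \<le> t < N}\<close>, where \<open>m\<close> runs through a box that is larger by a constant factor and so contains \<open>O(N\<^sup>d)\<close> points (\<open>sum_box_le_sum_lines\<close>).
\<close>

section \<open>Sums of reciprocals of primes\<close>

text \<open>
  All primes in \<open>(n, 2n]\<close> divide the central binomial coefficient \<open>2n choose n\<close>, which is at most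
  \<open>4\<^sup>n\<close>. For \<open>n = 2\<^sup>i\<close> both sides of the resulting inequality are powers of two, so that comparing
  exponents takes the place of logarithms.
\<close>
lemma card_primes_dyadic_le:
  "i * card {p. prime p \<and> 2 ^ i < p \<and> p \<le> (2::nat) ^ Suc i} \<le> 2 ^ Suc i"
proof -
  define n :: nat where "n = 2 ^ i"
  define A where "A = {p. prime p \<and> n < p \<and> p \<le> 2 * n}"
  define x where "x = 2 * n choose n"
  have [simp]: "finite A" unfolding A_def by simp
  have "x \<noteq> 0" by (simp add: x_def)
  have dvd: "p dvd x" if "p \<in> A" for p
  proof -
    from that have p: "prime p" "n < p" "p \<le> 2 * n" by (auto simp: A_def)
    have "p dvd fact (2 * n)" using p by (simp add: prime_dvd_fact_iff)
    also have "fact (2 * n) = fact n * fact n * x"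
      using binomial_fact_lemma[of n "2 * n"] by (simp add: x_def mult_2)
    finally show ?thesis
      using p by (auto simp: prime_dvd_mult_iff prime_dvd_fact_iff)
  qed
  have "2 ^ (i * card A) = (\<Prod>p\<in>A. n)" by (simp add: n_def power_mult)
  also have "\<dots> \<le> (\<Prod>p\<in>A. p)" by (intro prod_mono) (auto simp: A_def)
  also have "\<dots> \<le> (\<Prod>p\<in>A. p ^ multiplicity p x)"
  proof (intro prod_mono conjI)
    fix p assume "p \<in> A"
    then have "prime p" "multiplicity p x \<ge> 1"
      using dvd \<open>x \<noteq> 0\<close> by (auto simp: A_def prime_multiplicity_gt_zero_iff Suc_le_eq)
    then show "p \<le> p ^ multiplicity p x" by (intro self_le_power) (auto simp: prime_gt_0_nat Suc_le_eq)
  qed auto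
  also have "\<dots> \<le> (\<Prod>p\<in>prime_factors x. p ^ multiplicity p x)"
  proof (rule dvd_imp_le)
    show "(\<Prod>p\<in>A. p ^ multiplicity p x) dvd (\<Prod>p\<in>prime_factors x. p ^ multiplicity p x)"
      using dvd \<open>x \<noteq> 0\<close> by (intro prod_dvd_prod_subset) (auto simp: A_def in_prime_factors_iff)
  qed (auto intro!: prod_pos simp: prime_gt_0_nat in_prime_factors_iff)
  also have "\<dots> = x" using \<open>x \<noteq> 0\<close> by (simp add: prime_factorization_nat[symmetric])
  also have "x \<le> 2 ^ (2 * n)" unfolding x_def by (rule binomial_le_pow2)
  finally have "i * card A \<le> 2 * n" by (simp add: power_increasing_iff)
  then show ?thesis by (simp add: A_def n_def)
qed

lemma sum_reciprocal_primes_dyadic_le: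
  assumes "i \<ge> 1"
  shows "(\<Sum>p | prime p \<and> 2 ^ i < p \<and> p \<le> (2::nat) ^ Suc i. 1 / real p) \<le> 2 / real i"
proof -
  let ?A = "{p. prime p \<and> 2 ^ i < p \<and> p \<le> (2::nat) ^ Suc i}"
  have "(\<Sum>p\<in>?A. 1 / real p) \<le> (\<Sum>p\<in>?A. 1 / 2 ^ i)"
  proof (rule sum_mono)
    fix p assume "p \<in> ?A"
    then have "real (2 ^ i) \<le> real p" by (simp only: of_nat_le_iff) simp
    then have "2 ^ i \<le> real p" by simp
    moreover from this have "real p > 0" by (rule less_le_trans[rotated]) simp
    ultimately show "1 / real p \<le> 1 / 2 ^ i" by (intro divide_left_mono) auto
  qed
  also have "\<dots> = real (i * card ?A) / (i * 2 ^ i)" using assms by simp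
  also have "\<dots> \<le> real (2 ^ Suc i) / (i * 2 ^ i)"
    by (intro divide_right_mono of_nat_mono card_primes_dyadic_le) simp
  also have "\<dots> = 2 / real i" by simp
  finally show ?thesis .
qed

text \<open>
  The bounds \<open>2 / i\<close> for the dyadic blocks add up to a harmonic number of \<open>k \<approx> log\<^sub>2 N\<close>, whence the
  double logarithm in the next lemma.
\<close>
lemma sum_reciprocal_primes_pow2_le:
  "(\<Sum>p | prime p \<and> p \<le> (2::nat) ^ Suc k. 1 / real p) \<le> 1 / 2 + 2 * harm k"
proof (induction k)
  case 0
  have "{p. prime p \<and> p \<le> (2::nat)} = {2}" by (auto dest: prime_ge_2_nat)
  then show ?case by (simp add: harm_def)
next
  case (Suc k)
  let ?A = "{p. prime p \<and> p \<le> (2::nat) ^ Suc k}"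
  let ?B = "{p. prime p \<and> 2 ^ Suc k < p \<and> p \<le> (2::nat) ^ Suc (Suc k)}"
  have "{p. prime p \<and> p \<le> (2::nat) ^ Suc (Suc k)} = ?A \<union> ?B"
    by (auto intro: order_trans[where y = "2 ^ Suc k"])
  then have "(\<Sum>p | prime p \<and> p \<le> (2::nat) ^ Suc (Suc k). 1 / real p)
      = (\<Sum>p\<in>?A. 1 / real p) + (\<Sum>p\<in>?B. 1 / real p)"
    by (simp only:) (rule sum.union_disjoint, auto)
  also have "\<dots> \<le> (1 / 2 + 2 * harm k) + 2 / real (Suc k)"
    by (intro add_mono Suc.IH sum_reciprocal_primes_dyadic_le) simp
  also have "\<dots> = 1 / 2 + 2 * harm (Suc k)" by (simp add: harm_Suc field_simps)
  finally show ?case .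
qed

lemma sum_reciprocal_primes_le:
  assumes "N \<ge> (2::nat)"
  shows "(\<Sum>p | prime p \<and> p \<le> N. 1 / real p) \<le> 5 / 2 - 2 * ln (ln 2) + 2 * ln (ln (real N))"
proof -
  define k where "k = floor_log N"
  have k: "2 ^ k \<le> N" "N \<le> 2 ^ Suc k"
    using assms floor_log_exp2_le[of N] floor_log_exp2_ge[of N] by (simp_all add: k_def)
  have "k \<ge> 1" using assms floor_log_rec[of N] by (simp add: k_def)
  have "(\<Sum>p | prime p \<and> p \<le> N. 1 / real p) \<le> (\<Sum>p | prime p \<and> p \<le> (2::nat) ^ Suc k. 1 / real p)"
    using k by (intro sum_mono2) (auto intro: order_trans)
  also have "\<dots> \<le> 1 / 2 + 2 * harm k" by (rule sum_reciprocal_primes_pow2_le)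
  also have "\<dots> \<le> 1 / 2 + 2 * (ln (real k) + 1)" using \<open>k \<ge> 1\<close> euler_mascheroni_sequence_decreasing[of 1 k] by (simp add: harm_def)
  also have "ln (real k) \<le> ln (ln (real N) / ln 2)"
  proof (rule ln_mono)
    have "real k * ln 2 = ln (real (2 ^ k))" by (simp add: ln_realpow)
    also have "\<dots> \<le> ln (real N)" using k assms by (intro ln_mono of_nat_mono) auto
    finally show "real k \<le> ln (real N) / ln 2" by (simp add: field_simps)
  qed (use \<open>k \<ge> 1\<close> assms in auto)
  also have "\<dots> = ln (ln (real N)) - ln (ln 2)" using assms by (simp add: ln_div)
  finally show ?thesis by simp
qed

section \<open>Prime factors and small prime powers\<close>

text \<open>
  The cutoff is \<open>p ^ a \<le> N\<close> because a residue class modulo \<open>q \<le> N\<close> has at most \<open>2N / q\<close> members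
  among \<open>N\<close> consecutive integers, while no bound proportional to \<open>N / q\<close> holds for large \<open>q\<close>.
\<close>
definition small_prime_power_count :: "nat \<Rightarrow> int \<Rightarrow> nat" where
  "small_prime_power_count N x =
     (\<Sum>p | prime p \<and> p \<le> N. card {a. 1 \<le> a \<and> p ^ a \<le> N \<and> int p ^ a dvd x})"

lemma finite_exponents_le:
  assumes "prime (p::nat)"
  shows "finite {a. 1 \<le> a \<and> p ^ a \<le> N}"
proof (rule finite_subset)
  show "{a. 1 \<le> a \<and> p ^ a \<le> N} \<subseteq> {..N}"
    using power_gt_expt[of p] prime_gt_1_nat[OF assms] by (auto intro: less_imp_le less_le_trans)
qed simp

text \<open>
  Let \<open>c\<close> be the largest exponent with \<open>p ^ c \<le> N\<close> and \<open>p ^ c\<close> dividing \<open>M\<close>. Either \<open>c\<close> is already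
  the full multiplicity \<open>v\<close>, or \<open>p ^ (c + 1) > N\<close>; then \<open>p ^ v \<le> N ^ K \<le> p ^ ((c + 1) K)\<close>, and
  \<open>c + 1 \<le> 2 c\<close> because \<open>p\<close> itself is one of the prime powers counted.
\<close>
lemma multiplicity_le_small_exponents:
  fixes M N p K :: nat
  assumes p: "prime p" "p \<le> N" "p dvd M" and M: "M > 0" "M \<le> N ^ K"
  shows "multiplicity p M \<le> 2 * K * card {a. 1 \<le> a \<and> p ^ a \<le> N \<and> p ^ a dvd M}"
proof -
  define v where "v = multiplicity p M"
  define E where "E = {a. 1 \<le> a \<and> p ^ a \<le> N \<and> p ^ a dvd M}"
  have p1: "p > 1" using p prime_gt_1_nat by blast
  have dvd_iff: "p ^ a dvd M \<longleftrightarrow> a \<le> v" for a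
    unfolding v_def using M p1 by (intro power_dvd_iff_le_multiplicity) auto
  have "v \<ge> 1" using dvd_iff[of 1] p by simp
  have finE: "finite E" by (rule finite_subset[of _ "{..v}"]) (auto simp: E_def dvd_iff)
  have K: "K \<ge> 1"
  proof (rule ccontr)
    assume "\<not> K \<ge> 1"
    then have "K = 0" by simp
    then have "M = 1" using M by simp
    then show False using p p1 by simp
  qed
  define c where "c = Max E"
  have "1 \<in> E" using p by (simp add: E_def)
  then have "c \<in> E" "c \<ge> 1" unfolding c_def using finE by (auto intro: Max_in)
  have "{1..c} \<subseteq> E"
  proof
    fix a assume a: "a \<in> {1..c}"
    then have "p ^ a \<le> p ^ c" using p1 by (intro power_increasing) auto
    then show "a \<in> E" using a \<open>c \<in> E\<close> by (auto simp: E_def dvd_iff)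
  qed
  then have c: "c \<le> card E" using card_mono[OF finE, of "{1..c}"] by simp
  have "Suc c \<notin> E" using Max_ge[OF finE, of "Suc c"] by (auto simp: c_def)
  then consider "v \<le> c" | "N < p ^ Suc c" by (force simp: E_def dvd_iff)
  then have "v \<le> 2 * K * c"
  proof cases
    case 1
    also have "c \<le> 2 * K * c" using K by simp
    finally show ?thesis .
  next
    case 2
    have "p ^ v \<le> M" using M dvd_iff[of v] by (auto intro: dvd_imp_le)
    also have "M \<le> N ^ K" by fact
    also have "\<dots> \<le> (p ^ Suc c) ^ K" using 2 by (intro power_mono) auto
    also have "\<dots> = p ^ (Suc c * K)" by (simp only: power_mult)
    finally have "v \<le> Suc c * K" using p1 power_increasing_iff by blast
    also have "\<dots> \<le> (2 * c) * K" using \<open>c \<ge> 1\<close> by (intro mult_right_mono) auto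
    finally show ?thesis by (simp add: mult_ac)
  qed
  also have "\<dots> \<le> 2 * K * card E" using c by simp
  finally show ?thesis by (simp add: v_def E_def)
qed

text \<open>
  The prime factors exceeding \<open>N\<close> number at most \<open>K\<close> with multiplicity, since their product is at
  most \<open>N ^ K\<close>; the others are covered by the preceding lemma.
\<close>
lemma big_omega_le:
  fixes M N K :: nat
  assumes M: "M > 0" "M \<le> N ^ K" and N: "N \<ge> 2"
  shows "big_omega M \<le> 2 * K * small_prime_power_count N (int M) + K"
proof -
  define A where "A = {p\<in>prime_factors M. p \<le> N}"
  define B where "B = {p\<in>prime_factors M. p > N}"
  have [simp]: "finite A" "finite B" by (auto simp: A_def B_def)
  have AB: "prime_factors M = A \<union> B" "A \<inter> B = {}" by (auto simp: A_def B_def)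
  have "big_omega M = (\<Sum>p\<in>prime_factors M. multiplicity p M)"
    unfolding big_omega_def size_multiset_overloaded_eq
    by (intro sum.cong refl) (auto simp: count_prime_factorization_prime in_prime_factors_iff)
  also have "\<dots> = (\<Sum>p\<in>A. multiplicity p M) + (\<Sum>p\<in>B. multiplicity p M)"
    unfolding AB(1) using AB(2) by (intro sum.union_disjoint) auto
  also have "(\<Sum>p\<in>A. multiplicity p M) \<le> 2 * K * small_prime_power_count N (int M)"
  proof -
    have eq: "{a. 1 \<le> a \<and> p ^ a \<le> N \<and> int p ^ a dvd int M} = {a. 1 \<le> a \<and> p ^ a \<le> N \<and> p ^ a dvd M}"
      for p by (simp flip: of_nat_power)
    have "(\<Sum>p\<in>A. multiplicity p M)
        \<le> (\<Sum>p\<in>A. 2 * K * card {a. 1 \<le> a \<and> p ^ a \<le> N \<and> p ^ a dvd M})"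
      using M by (intro sum_mono multiplicity_le_small_exponents) (auto simp: A_def)
    also have "\<dots> \<le> (\<Sum>p | prime p \<and> p \<le> N. 2 * K * card {a. 1 \<le> a \<and> p ^ a \<le> N \<and> p ^ a dvd M})"
      by (intro sum_mono2) (auto simp: A_def)
    finally show ?thesis by (simp only: small_prime_power_count_def sum_distrib_left eq)
  qed
  also have "(\<Sum>p\<in>B. multiplicity p M) \<le> K"
  proof -
    have "N ^ (\<Sum>p\<in>B. multiplicity p M) = (\<Prod>p\<in>B. N ^ multiplicity p M)" by (simp add: power_sum)
    also have "\<dots> \<le> (\<Prod>p\<in>B. p ^ multiplicity p M)"
      by (intro prod_mono) (auto simp: B_def intro!: power_mono)
    also have "\<dots> \<le> (\<Prod>p\<in>prime_factors M. p ^ multiplicity p M)"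
    proof (rule dvd_imp_le)
      show "(\<Prod>p\<in>B. p ^ multiplicity p M) dvd (\<Prod>p\<in>prime_factors M. p ^ multiplicity p M)"
        by (intro prod_dvd_prod_subset) (auto simp: B_def)
    qed (auto intro!: prod_pos simp: prime_gt_0_nat in_prime_factors_iff)
    also have "\<dots> = M" using M by (simp add: prime_factorization_nat[symmetric])
    also have "M \<le> N ^ K" by fact
    finally show ?thesis using N by simp
  qed
  finally show ?thesis by simp
qed

section \<open>Roots of integer polynomials modulo prime powers\<close>

text \<open>
  Write \<open>f(t) - f(u) = (t - u) g(t)\<close> for one of the points \<open>u\<close>. At the other points \<open>t - u\<close> contains
  \<open>p\<close> at most \<open>b\<close> times, so \<open>g\<close>, of degree one less and with the same top coefficient, satisfies the
  hypothesis with \<open>s + b\<close> in place of \<open>s\<close>. The factor \<open>p ^ s\<close> is there for this induction. The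
  coefficient \<open>coeff f k\<close> replaces \<open>lead_coeff f\<close> so that no case distinction on the exact degree
  arises.
\<close>
lemma prime_power_dvd_leading_coeff:
  fixes f :: "int poly" and p :: int
  assumes p: "prime p" and "degree f \<le> k" and "card S = Suc k"
    and "\<And>t. t \<in> S \<Longrightarrow> p ^ a dvd p ^ s * poly f t"
    and "\<And>t u. t \<in> S \<Longrightarrow> u \<in> S \<Longrightarrow> t \<noteq> u \<Longrightarrow> \<not> p ^ Suc b dvd t - u"
  shows "p ^ a dvd p ^ (s + k * b) * coeff f k"
  using assms(2-)
proof (induction k arbitrary: f s S)
  case 0
  then obtain t where "S = {t}" by (auto simp: card_1_singleton_iff)
  moreover have "poly f t = coeff f 0" using 0 by (auto elim!: degree_eq_zeroE)
  ultimately show ?case using 0(3)[of t] by simp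
next
  case (Suc k)
  have "finite S" using Suc.prems(2) by (metis card.infinite nat.distinct(1))
  obtain u where u: "u \<in> S" using Suc.prems(2) by (metis card.empty equals0I nat.distinct(1))
  define g where "g = synthetic_div f u"
  have dg: "degree g \<le> k" using Suc.prems(1) by (simp add: g_def degree_synthetic_div)
  have f: "f = [:-u, 1:] * g + [:poly f u:]" by (simp only: g_def synthetic_div_correct')
  have "coeff f (Suc k) = coeff g k"
    using dg by (subst f) (simp add: coeff_eq_0)
  moreover have "p ^ a dvd p ^ (s + b + k * b) * coeff g k"
  proof (rule Suc.IH[OF dg])
    show "card (S - {u}) = Suc k" using Suc.prems(2) u \<open>finite S\<close> by simp
  next
    fix t assume t: "t \<in> S - {u}"
    have "t - u \<noteq> 0" "\<not> is_unit p" using t p by auto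
    then obtain w where w: "t - u = p ^ multiplicity p (t - u) * w" "\<not> p dvd w"
      by (metis multiplicity_decompose')
    define c where "c = multiplicity p (t - u)"
    have cb: "c \<le> b"
    proof (rule ccontr)
      assume "\<not> c \<le> b"
      then have "p ^ Suc b dvd p ^ c" by (intro le_imp_power_dvd) simp
      then have "p ^ Suc b dvd t - u" using w c_def by (metis dvd_mult2)
      then show False using Suc.prems(4)[of t u] t u by auto
    qed
    have "p ^ a dvd p ^ s * poly f t - p ^ s * poly f u"
      using Suc.prems(3)[of t] Suc.prems(3)[of u] t u by (intro dvd_diff) auto
    also have "\<dots> = p ^ s * (poly f t - poly f u)" by (simp add: algebra_simps)
    also have "poly f t - poly f u = (t - u) * poly g t"
      by (subst f) (simp add: algebra_simps)
    also have "p ^ s * ((t - u) * poly g t) = (p ^ (s + c) * poly g t) * w"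
      using w(1) by (simp add: c_def power_add mult_ac)
    finally have "p ^ a dvd p ^ (s + c) * poly g t"
      using p w(2) by (simp add: coprime_dvd_mult_left_iff prime_imp_coprime coprime_power_left_iff)
    also have "\<dots> dvd p ^ (s + b) * poly g t"
      using cb by (intro mult_dvd_mono le_imp_power_dvd) auto
    finally show "p ^ a dvd p ^ (s + b) * poly g t" .
  next
    fix t t' assume "t \<in> S - {u}" "t' \<in> S - {u}" "t \<noteq> t'"
    then show "\<not> p ^ Suc b dvd t - t'" using Suc.prems(4) by auto
  qed
  ultimately show ?case by (simp add: algebra_simps)
qed

lemma card_residue_class_le:
  fixes q r :: int
  assumes "q > 0"
  shows "card {t\<in>{0..<int N}. t mod q = r} \<le> N div nat q + 1"
proof -
  have "card {t\<in>{0..<int N}. t mod q = r} \<le> card {0..int N div q}"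
  proof (rule card_inj_on_le)
    show "inj_on (\<lambda>t. t div q) {t\<in>{0..<int N}. t mod q = r}"
      by (rule inj_onI) (metis (mono_tags, lifting) div_mult_mod_eq mem_Collect_eq)
    show "(\<lambda>t. t div q) ` {t\<in>{0..<int N}. t mod q = r} \<subseteq> {0..int N div q}"
      using assms by (auto simp: pos_imp_zdiv_nonneg_iff intro!: zdiv_mono1)
  qed simp
  also have "\<dots> = N div nat q + 1"
    using assms by (simp add: nat_add_distrib pos_imp_zdiv_nonneg_iff nat_div_distrib)
  finally show ?thesis .
qed

text \<open>
  The condition on \<open>a\<close> says that \<open>p ^ a\<close> does not divide \<open>p ^ (k b)\<close> times the top coefficient, so by
  \<open>prime_power_dvd_leading_coeff\<close> the solutions cannot meet \<open>k + 1\<close> residue classes modulo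
  \<open>p ^ (b + 1)\<close>.
\<close>
lemma card_solutions_prime_power_le:
  fixes f :: "int poly" and p a b k N :: nat
  assumes p: "prime p" and f: "degree f \<le> k" "coeff f k \<noteq> 0"
    and a: "multiplicity (int p) (coeff f k) + k * b < a"
    and N: "p ^ Suc b \<le> N"
  shows "card {t\<in>{0..<int N}. int p ^ a dvd poly f t} \<le> 2 * k * N / real p ^ Suc b"
proof -
  define q where "q = int p ^ Suc b"
  define T where "T = {t\<in>{0..<int N}. int p ^ a dvd poly f t}"
  have q: "q > 0" using p prime_gt_0_nat by (simp add: q_def)
  have [simp]: "finite T" by (rule finite_subset[of _ "{0..<int N}"]) (auto simp: T_def)
  have pint: "prime (int p)" using p by simp
  have residues: "card ((\<lambda>t. t mod q) ` T) \<le> k"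
  proof (rule ccontr)
    assume "\<not> ?thesis"
    then obtain R where R: "R \<subseteq> (\<lambda>t. t mod q) ` T" "card R = Suc k"
      by (metis not_less_eq_eq obtain_subset_with_card_n)
    then obtain S where S: "S \<subseteq> T" "inj_on (\<lambda>t. t mod q) S" "R = (\<lambda>t. t mod q) ` S"
      by (auto simp: subset_image_inj)
    have "int p ^ a dvd int p ^ (0 + k * b) * coeff f k"
    proof (rule prime_power_dvd_leading_coeff[OF pint f(1)])
      show "card S = Suc k" using R S by (simp add: card_image)
      show "int p ^ a dvd int p ^ 0 * poly f t" if "t \<in> S" for t
        using that S by (auto simp: T_def)
      show "\<not> int p ^ Suc b dvd t - u" if "t \<in> S" "u \<in> S" "t \<noteq> u" for t u
        using that S(2) by (auto simp: q_def mod_eq_dvd_iff dest: inj_onD)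
    qed
    then have "a \<le> multiplicity (int p) (int p ^ (k * b) * coeff f k)"
      using pint f(2) by (subst (asm) power_dvd_iff_le_multiplicity) auto
    also have "\<dots> = k * b + multiplicity (int p) (coeff f k)"
      using pint f(2) by (subst prime_elem_multiplicity_mult_distrib) auto
    finally show False using a by simp
  qed
  have "T \<subseteq> (\<Union>r\<in>(\<lambda>t. t mod q) ` T. {t\<in>{0..<int N}. t mod q = r})"
    by (auto simp: T_def)
  then have "card T \<le> card (\<Union>r\<in>(\<lambda>t. t mod q) ` T. {t\<in>{0..<int N}. t mod q = r})"
    by (intro card_mono finite_UN_I finite_imageI)
      (auto intro: finite_subset[of _ "{0..<int N}"])
  also have "\<dots> \<le> (\<Sum>r\<in>(\<lambda>t. t mod q) ` T. card {t\<in>{0..<int N}. t mod q = r})"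
    by (intro card_UN_le) simp
  also have "\<dots> \<le> (\<Sum>r\<in>(\<lambda>t. t mod q) ` T. N div nat q + 1)"
    by (intro sum_mono card_residue_class_le q)
  also have "\<dots> \<le> k * (N div nat q + 1)"
    using mult_right_mono[OF residues, of "N div nat q + 1"] by simp
  finally have "real (card T) \<le> k * (real (N div nat q) + 1)"
    by (metis (no_types, lifting) of_nat_1 of_nat_add of_nat_le_iff of_nat_mult)
  also have "\<dots> \<le> k * (2 * N / real p ^ Suc b)"
  proof (rule mult_left_mono)
    have nq: "nat q = p ^ Suc b" by (simp add: q_def nat_power_eq flip: of_nat_power of_nat_mult)
    have "real (N div nat q) \<le> real N / real p ^ Suc b"
      using of_nat_div_le_of_nat[of N "nat q", where 'a = real] by (simp only: nq of_nat_power)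
    moreover have "1 \<le> real N / real p ^ Suc b"
    proof -
      have "real p ^ Suc b \<le> real N" using N by (metis of_nat_le_iff of_nat_power)
      then show ?thesis using p prime_gt_0_nat by (simp add: field_simps)
    qed
    ultimately have "real (N div nat q) + 1 \<le> real N / real p ^ Suc b + real N / real p ^ Suc b"
      by (rule add_mono)
    then show "real (N div nat q) + 1 \<le> 2 * N / real p ^ Suc b" by simp
  qed simp
  finally show ?thesis by (simp add: T_def mult_ac)
qed

text \<open>
  Each power of \<open>x\<close> occurs at most \<open>k\<close> times, and the geometric series is at most \<open>2\<close>.
\<close>
lemma sum_power_div_le:
  fixes x :: real
  assumes x: "0 \<le> x" "x \<le> 1 / 2" and k: "k \<ge> 1" and J: "finite J"
  shows "(\<Sum>j\<in>J. x ^ (j div k)) \<le> 2 * k"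
proof -
  obtain n where n: "J \<subseteq> {..<n * k}"
  proof -
    obtain m where "\<forall>j\<in>J. j < m" using J finite_nat_set_iff_bounded by blast
    moreover have "m \<le> m * k" using k by simp
    ultimately have "J \<subseteq> {..<m * k}" by (auto intro: less_le_trans)
    then show ?thesis by (rule that)
  qed
  have "(\<Sum>j\<in>J. x ^ (j div k)) \<le> (\<Sum>j<n * k. x ^ (j div k))"
    using n x by (intro sum_mono2) auto
  also have "\<dots> = (\<Sum>m<n. \<Sum>j\<in>{m * k..<m * k + k}. x ^ (j div k))"
    by (rule sum.nat_group[symmetric])
  also have "\<dots> = (\<Sum>m<n. \<Sum>j\<in>{m * k..<m * k + k}. x ^ m)"
    by (intro sum.cong refl arg_cong[where f = "power x"]) (auto intro!: div_nat_eqI simp: mult_ac)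
  also have "\<dots> = k * (\<Sum>m<n. x ^ m)" by (simp add: sum_distrib_left)
  also have "\<dots> \<le> real k * 2"
  proof (intro mult_left_mono)
    have "(\<Sum>m<n. x ^ m) \<le> (\<Sum>m<n. (1 / 2) ^ m)" using x by (intro sum_mono power_mono) auto
    also have "\<dots> \<le> (2::real)" by (subst geometric_sum) (auto simp: field_simps)
    finally show "(\<Sum>m<n. x ^ m) \<le> 2" .
  qed simp
  finally show ?thesis by (simp add: mult_ac)
qed

text \<open>
  For exponents up to the multiplicity of \<open>p\<close> in the top coefficient only the trivial bound \<open>N\<close> is
  available. Beyond it, the density of solutions decreases geometrically in blocks of \<open>k\<close>
  exponents, starting at \<open>2k / p\<close>.
\<close>
lemma sum_card_solutions_le:
  fixes f :: "int poly" and p k N :: nat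
  assumes p: "prime p" and f: "degree f \<le> k" "coeff f k \<noteq> 0" and k: "k \<ge> 1"
  shows "(\<Sum>a | 1 \<le> a \<and> p ^ a \<le> N. real (card {t\<in>{0..<int N}. int p ^ a dvd poly f t}))
         \<le> N * (multiplicity (int p) (coeff f k) + 4 * k\<^sup>2 * (1 / p))"
proof -
  define v where "v = multiplicity (int p) (coeff f k)"
  define c where "c = (\<lambda>a. real (card {t\<in>{0..<int N}. int p ^ a dvd poly f t}))"
  define E where "E = {a. 1 \<le> a \<and> p ^ a \<le> N}"
  have [simp]: "finite E" unfolding E_def by (rule finite_exponents_le[OF p])
  have p2: "p \<ge> 2" using p prime_ge_2_nat by blast
  have c_le: "c a \<le> N" for a
  proof -
    have "card {t\<in>{0..<int N}. int p ^ a dvd poly f t} \<le> card {0..<int N}"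
      by (intro card_mono) auto
    then show ?thesis by (simp add: c_def)
  qed
  have "(\<Sum>a\<in>E. c a) = (\<Sum>a\<in>E \<inter> {..v}. c a) + (\<Sum>a\<in>E - {..v}. c a)"
    by (simp add: sum.Int_Diff)
  also have "(\<Sum>a\<in>E \<inter> {..v}. c a) \<le> N * v"
  proof -
    have "(\<Sum>a\<in>E \<inter> {..v}. c a) \<le> (\<Sum>a\<in>E \<inter> {..v}. real N)" by (intro sum_mono c_le)
    also have "\<dots> \<le> (\<Sum>a\<in>{1..v}. real N)" by (intro sum_mono2) (auto simp: E_def)
    finally show ?thesis by (simp add: mult.commute)
  qed
  also have "(\<Sum>a\<in>E - {..v}. c a) \<le> (2 * k * N / p) * (2 * k)"
  proof -
    have "c a \<le> (2 * k * N / p) * (1 / p) ^ ((a - Suc v) div k)" if "a \<in> E - {..v}" for a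
    proof -
      define b where "b = (a - Suc v) div k"
      have a: "v < a" "p ^ a \<le> N" using that by (auto simp: E_def)
      have kb: "k * b \<le> a - Suc v" by (simp add: b_def)
      moreover have "b \<le> k * b" using k by simp
      ultimately have "Suc b \<le> a" using a by linarith
      then have "p ^ Suc b \<le> p ^ a" using p2 by (intro power_increasing) auto
      also have "\<dots> \<le> N" by fact
      finally have "c a \<le> 2 * k * N / real p ^ Suc b"
        unfolding c_def using a kb by (intro card_solutions_prime_power_le p f) (auto simp: v_def)
      then show ?thesis by (simp add: b_def power_one_over field_simps)
    qed
    then have "(\<Sum>a\<in>E - {..v}. c a) \<le> (\<Sum>a\<in>E - {..v}. (2 * k * N / p) * (1 / p) ^ ((a - Suc v) div k))"
      by (rule sum_mono)
    also have "\<dots> = (2 * k * N / p) * (\<Sum>a\<in>E - {..v}. (1 / p) ^ ((a - Suc v) div k))"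
      by (simp add: sum_distrib_left)
    also have "\<dots> \<le> (2 * k * N / p) * (2 * k)"
    proof (intro mult_left_mono)
      have "(\<Sum>a\<in>E - {..v}. (1 / real p) ^ ((a - Suc v) div k))
        = (\<Sum>j\<in>(\<lambda>a. a - Suc v) ` (E - {..v}). (1 / real p) ^ (j div k))"
        by (subst sum.reindex) (auto simp: inj_on_def)
      also have "\<dots> \<le> 2 * k"
        using p2 k by (intro sum_power_div_le) (auto simp: field_simps)
      finally show "(\<Sum>a\<in>E - {..v}. (1 / real p) ^ ((a - Suc v) div k)) \<le> 2 * k" .
    qed simp
    finally show ?thesis .
  qed
  finally show ?thesis
    by (simp add: c_def E_def v_def algebra_simps power2_eq_square)
qed

lemma sum_multiplicity_primes_le:
  assumes "A \<noteq> (0::int)"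
  shows "(\<Sum>p | prime p \<and> p \<le> N. multiplicity (int p) A) \<le> big_omega (nat \<bar>A\<bar>)"
proof -
  let ?M = "nat \<bar>A\<bar>"
  have mult: "multiplicity (int p) A = count (prime_factorization ?M) p" if "prime p" for p
  proof -
    have "multiplicity (int p) A = multiplicity (int p) (int ?M)"
      by (simp add: abs_if multiplicity_uminus_right)
    also have "\<dots> = multiplicity p ?M" by (simp only: multiplicity_def of_nat_dvd_iff flip: of_nat_power)
    finally show ?thesis using that by (simp add: count_prime_factorization_prime)
  qed
  have "(\<Sum>p | prime p \<and> p \<le> N. multiplicity (int p) A)
      = (\<Sum>p | prime p \<and> p \<le> N. count (prime_factorization ?M) p)"
    by (intro sum.cong refl mult) auto
  also have "\<dots> \<le> (\<Sum>p\<in>{p. prime p \<and> p \<le> N} \<union> prime_factors ?M. count (prime_factorization ?M) p)"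
    by (intro sum_mono2) auto
  also have "\<dots> = big_omega ?M"
    unfolding big_omega_def size_multiset_overloaded_eq
    by (intro sum.mono_neutral_right) (auto simp: not_in_iff)
  finally show ?thesis .
qed

text \<open>
  The top coefficient contributes only a bounded amount for all primes together, because the
  sum of its multiplicities is its number of prime factors.
\<close>
lemma sum_small_prime_power_count_le:
  fixes f :: "int poly" and k N :: nat
  assumes f: "degree f \<le> k" "coeff f k \<noteq> 0" and k: "k \<ge> 1"
  shows "(\<Sum>t\<in>{0..<int N}. real (small_prime_power_count N (poly f t)))
         \<le> N * (big_omega (nat \<bar>coeff f k\<bar>) + 4 * k\<^sup>2 * (\<Sum>p | prime p \<and> p \<le> N. 1 / p))"
proof -
  let ?P = "{p. prime p \<and> p \<le> N}"
  let ?E = "\<lambda>p. {a. 1 \<le> a \<and> p ^ a \<le> N}"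
  let ?T = "\<lambda>p a. {t\<in>{0..<int N}. int p ^ a dvd poly f t}"
  have "(\<Sum>t\<in>{0..<int N}. small_prime_power_count N (poly f t))
      = (\<Sum>p\<in>?P. \<Sum>t\<in>{0..<int N}. card {a\<in>?E p. int p ^ a dvd poly f t})"
    unfolding small_prime_power_count_def by (subst sum.swap) (simp add: conj_assoc)
  also have "\<dots> = (\<Sum>p\<in>?P. \<Sum>a\<in>?E p. card (?T p a))"
    by (intro sum.cong refl sum_multicount_gen) (use finite_exponents_le in auto)
  finally have "(\<Sum>t\<in>{0..<int N}. real (small_prime_power_count N (poly f t)))
      = (\<Sum>p\<in>?P. \<Sum>a\<in>?E p. real (card (?T p a)))"
    by (simp flip: of_nat_sum)
  also have "\<dots> \<le> (\<Sum>p\<in>?P. N * (multiplicity (int p) (coeff f k) + 4 * k\<^sup>2 * (1 / p)))"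
    by (intro sum_mono sum_card_solutions_le f k) auto
  also have "\<dots> = N * (real (\<Sum>p\<in>?P. multiplicity (int p) (coeff f k)) + 4 * k\<^sup>2 * (\<Sum>p\<in>?P. 1 / p))"
    by (simp add: sum.distrib sum_distrib_left algebra_simps)
  also have "\<dots> \<le> N * (real (big_omega (nat \<bar>coeff f k\<bar>)) + 4 * k\<^sup>2 * (\<Sum>p\<in>?P. 1 / p))"
    by (intro mult_left_mono add_right_mono of_nat_mono sum_multiplicity_primes_le f) auto
  finally show ?thesis .
qed

section \<open>Homogeneous polynomials along lines\<close>

lemma coeff_mult_degree_le:
  fixes p q :: "'a :: comm_semiring_0 poly"
  assumes "degree p \<le> m" "degree q \<le> n"
  shows "coeff (p * q) (m + n) = coeff p m * coeff q n"
proof (cases "degree p = m \<and> degree q = n")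
  case True
  then show ?thesis using coeff_mult_degree_sum[of p q] by simp
next
  case False
  then have lt: "degree p + degree q < m + n" using assms by linarith
  have "coeff (p * q) (m + n) = 0"
    using lt degree_mult_le[of p q] by (intro coeff_eq_0) linarith
  moreover have "coeff p m * coeff q n = 0"
    using False assms by (auto simp: coeff_eq_0)
  ultimately show ?thesis by simp
qed

lemma linear_power_top_coeff:
  fixes a b :: "'a :: comm_semiring_1"
  shows "degree ([:a, b:] ^ n) \<le> n" "coeff ([:a, b:] ^ n) n = b ^ n"
proof -
  show deg: "degree ([:a, b:] ^ n) \<le> n" for n
    using degree_power_le[of "[:a, b:]" n] by (auto split: if_splits)
  have lin: "degree [:a, b:] \<le> 1" by simp
  show "coeff ([:a, b:] ^ n) n = b ^ n"
  proof (induction n)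
    case (Suc n)
    then show ?case using coeff_mult_degree_le[OF lin deg[of n]] by simp
  qed simp
qed

lemma prod_linear_power_top_coeff:
  fixes a b :: "'i \<Rightarrow> 'a :: comm_semiring_1"
  assumes "finite A"
  shows "degree (\<Prod>i\<in>A. [:a i, b i:] ^ e i) \<le> (\<Sum>i\<in>A. e i) \<and>
         coeff (\<Prod>i\<in>A. [:a i, b i:] ^ e i) (\<Sum>i\<in>A. e i) = (\<Prod>i\<in>A. b i ^ e i)"
  using assms
proof (induction A)
  case (insert x A)
  have "degree ([:a x, b x:] ^ e x * (\<Prod>i\<in>A. [:a i, b i:] ^ e i)) \<le> e x + (\<Sum>i\<in>A. e i)"
    using insert.IH by (intro order_trans[OF degree_mult_le] add_mono linear_power_top_coeff) auto
  moreover have "coeff ([:a x, b x:] ^ e x * (\<Prod>i\<in>A. [:a i, b i:] ^ e i)) (e x + (\<Sum>i\<in>A. e i))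
      = b x ^ e x * (\<Prod>i\<in>A. b i ^ e i)"
    using insert.IH by (subst coeff_mult_degree_le) (auto simp: linear_power_top_coeff)
  ultimately show ?case using insert.hyps by simp
qed simp

text \<open>
  Evaluating at linear polynomials \<open>x\<^sub>i + t y\<^sub>i\<close> yields the restriction to a line as a polynomial
  in \<open>t\<close>. Each monomial of degree \<open>k\<close> contributes to the coefficient of \<open>t\<^sup>k\<close> its value at \<open>y\<close>,
  independently of the base point \<open>x\<close>.
\<close>
lemma eval_mpoly_line:
  fixes x y :: "nat \<Rightarrow> int"
  assumes "\<And>m. m \<in> Poly_Mapping.keys P \<Longrightarrow> monomial_degree m = k"
  defines "f \<equiv> eval_mpoly P (\<lambda>i. [:x i, y i:])"
  shows "degree f \<le> k" "coeff f k = eval_mpoly P y" "poly f t = eval_mpoly P (\<lambda>i. x i + t * y i)"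
proof -
  let ?mon = "\<lambda>m. \<Prod>i\<in>Poly_Mapping.keys m. [:x i, y i:] ^ Poly_Mapping.lookup m i"
  have f: "f = (\<Sum>m\<in>Poly_Mapping.keys P. smult (Poly_Mapping.lookup P m) (?mon m))"
    by (simp add: f_def eval_mpoly_def of_int_poly)
  have mon: "degree (?mon m) \<le> k"
    "coeff (?mon m) k = (\<Prod>i\<in>Poly_Mapping.keys m. y i ^ Poly_Mapping.lookup m i)"
    if "m \<in> Poly_Mapping.keys P" for m
    using prod_linear_power_top_coeff[of "Poly_Mapping.keys m" x y "Poly_Mapping.lookup m"]
      assms(1)[OF that] by (auto simp: monomial_degree_def)
  show "degree f \<le> k"
    unfolding f using mon(1) by (intro degree_sum_le) (auto intro: order_trans[OF degree_smult_le])
  show "coeff f k = eval_mpoly P y"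
    using mon(2) by (simp add: f coeff_sum eval_mpoly_def)
  show "poly f t = eval_mpoly P (\<lambda>i. x i + t * y i)"
    by (simp add: f eval_mpoly_def poly_sum poly_prod mult.commute)
qed

lemma base_digits_unique:
  fixes a b :: "nat \<Rightarrow> nat"
  assumes "\<And>i. i < d \<Longrightarrow> a i < D" "\<And>i. i < d \<Longrightarrow> b i < D"
    and "(\<Sum>i<d. a i * D ^ i) = (\<Sum>i<d. b i * D ^ i)" and "i < d"
  shows "a i = b i"
  using assms
proof (induction d arbitrary: a b i)
  case (Suc d)
  have split: "(\<Sum>i<Suc d. c i * D ^ i) = c 0 + D * (\<Sum>i<d. c (Suc i) * D ^ i)" for c :: "nat \<Rightarrow> nat"
    by (subst sum.lessThan_Suc_shift) (simp add: sum_distrib_left mult_ac)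
  have eq: "a 0 + D * (\<Sum>i<d. a (Suc i) * D ^ i) = b 0 + D * (\<Sum>i<d. b (Suc i) * D ^ i)"
    using Suc.prems(3) by (simp only: split)
  have lt: "a 0 < D" "b 0 < D" using Suc.prems by auto
  from arg_cong[OF eq, of "\<lambda>x. x mod D"] have 0: "a 0 = b 0" using lt by simp
  with eq lt have sums: "(\<Sum>i<d. a (Suc i) * D ^ i) = (\<Sum>i<d. b (Suc i) * D ^ i)" by simp
  have "a (Suc j) = b (Suc j)" if "j < d" for j
    by (rule Suc.IH[OF _ _ sums that]) (simp_all add: Suc.prems(1,2))
  then show ?case using 0 Suc.prems(4) by (cases i) simp_all
qed simp

text \<open>
  Kronecker substitution: with \<open>D\<close> larger than all exponents, substituting \<open>X ^ (D ^ i)\<close> for the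
  \<open>i\<close>-th variable sends distinct monomials to distinct powers of \<open>X\<close>, since the exponent of the
  image has the original exponents as its digits in base \<open>D\<close>. The resulting univariate polynomial
  is nonzero, so it has a natural number among its non-roots.
\<close>
lemma ex_nonzero_eval_mpoly:
  assumes "in_vars d P" "P \<noteq> 0"
  obtains v :: "nat \<Rightarrow> nat" where "eval_mpoly P (\<lambda>i. int (v i)) \<noteq> 0"
proof -
  define D where "D = Suc (\<Sum>m\<in>Poly_Mapping.keys P. \<Sum>i<d. Poly_Mapping.lookup m i)"
  define code where "code = (\<lambda>m. \<Sum>i<d. Poly_Mapping.lookup m i * D ^ i)"
  have vars: "Poly_Mapping.keys m \<subseteq> {..<d}" if "m \<in> Poly_Mapping.keys P" for m
    using assms(1) that by (auto simp: in_vars_def)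
  have digit: "Poly_Mapping.lookup m i < D" if "m \<in> Poly_Mapping.keys P" "i < d" for m i
  proof -
    have "Poly_Mapping.lookup m i \<le> (\<Sum>i<d. Poly_Mapping.lookup m i)"
      using that by (intro member_le_sum) auto
    also have "\<dots> \<le> (\<Sum>m\<in>Poly_Mapping.keys P. \<Sum>i<d. Poly_Mapping.lookup m i)"
      using that by (intro member_le_sum[where f = "\<lambda>m. \<Sum>i<d. Poly_Mapping.lookup m i"]) auto
    finally show ?thesis by (simp add: D_def)
  qed
  have code_inj: "m = m'"
    if "m \<in> Poly_Mapping.keys P" "m' \<in> Poly_Mapping.keys P" "code m = code m'" for m m'
  proof (rule poly_mapping_eqI)
    fix i
    show "Poly_Mapping.lookup m i = Poly_Mapping.lookup m' i"
    proof (cases "i < d")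
      case True
      show ?thesis
        by (rule base_digits_unique[where d = d and D = D])
          (use that digit True in \<open>auto simp: code_def\<close>)
    next
      case False
      then show ?thesis
        using vars[OF that(1)] vars[OF that(2)] by (metis in_keys_iff lessThan_iff subsetD)
    qed
  qed
  define F where "F = eval_mpoly P (\<lambda>i. [:0, 1::int:] ^ (D ^ i))"
  have "F = (\<Sum>m\<in>Poly_Mapping.keys P. monom (Poly_Mapping.lookup P m) (code m))"
    unfolding F_def eval_mpoly_def
  proof (intro sum.cong refl)
    fix m assume m: "m \<in> Poly_Mapping.keys P"
    have "(\<Prod>i\<in>Poly_Mapping.keys m. ([:0, 1::int:] ^ (D ^ i)) ^ Poly_Mapping.lookup m i)
        = (\<Prod>i<d. [:0, 1:] ^ (Poly_Mapping.lookup m i * D ^ i))"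
    proof (intro prod.mono_neutral_cong_left ballI)
      fix i
      show "([:0, 1::int:] ^ (D ^ i)) ^ Poly_Mapping.lookup m i
          = [:0, 1:] ^ (Poly_Mapping.lookup m i * D ^ i)"
        by (subst mult.commute) (rule power_mult[symmetric])
    qed (use vars[OF m] in \<open>auto simp: in_keys_iff\<close>)
    also have "\<dots> = [:0, 1:] ^ code m" by (simp add: code_def power_sum)
    finally show "of_int (Poly_Mapping.lookup P m) *
        (\<Prod>i\<in>Poly_Mapping.keys m. ([:0, 1::int:] ^ (D ^ i)) ^ Poly_Mapping.lookup m i)
        = monom (Poly_Mapping.lookup P m) (code m)"
      by (simp add: monom_altdef of_int_poly)
  qed
  moreover obtain m0 where m0: "m0 \<in> Poly_Mapping.keys P"
    using \<open>P \<noteq> 0\<close> by (metis all_not_in_conv keys_eq_empty)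
  ultimately have "coeff F (code m0)
      = (\<Sum>m\<in>Poly_Mapping.keys P. if code m = code m0 then Poly_Mapping.lookup P m else 0)"
    by (simp add: coeff_sum)
  also have "\<dots> = (\<Sum>m\<in>Poly_Mapping.keys P. if m = m0 then Poly_Mapping.lookup P m else 0)"
    using code_inj m0 by (intro sum.cong) auto
  also have "\<dots> \<noteq> 0" using m0 by (simp add: sum.delta in_keys_iff)
  finally have "F \<noteq> 0" by auto
  then have "finite {x. poly F x = 0}" by (rule poly_roots_finite)
  then have "\<not> {0::int..} \<subseteq> {x. poly F x = 0}" using infinite_Ici finite_subset by blast
  then obtain x :: int where x: "x \<ge> 0" "poly F x \<noteq> 0" by auto
  have "poly F x = eval_mpoly P (\<lambda>i. int (nat x ^ (D ^ i)))"
    using x(1) by (simp add: F_def eval_mpoly_def poly_sum poly_prod)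
  with x(2) have "eval_mpoly P (\<lambda>i. int (nat x ^ (D ^ i))) \<noteq> 0" by (simp only: not_False_eq_True)
  then show ?thesis by (rule that)
qed

lemma abs_eval_mpoly_le:
  fixes x :: "nat \<Rightarrow> int"
  assumes "in_vars d P" "\<And>m. m \<in> Poly_Mapping.keys P \<Longrightarrow> monomial_degree m = k"
    and "\<And>i. i < d \<Longrightarrow> \<bar>x i\<bar> \<le> B"
  shows "\<bar>eval_mpoly P x\<bar> \<le> (\<Sum>m\<in>Poly_Mapping.keys P. \<bar>Poly_Mapping.lookup P m\<bar>) * B ^ k"
proof -
  have "\<bar>eval_mpoly P x\<bar> \<le> (\<Sum>m\<in>Poly_Mapping.keys P. \<bar>Poly_Mapping.lookup P m\<bar> * B ^ k)"
    unfolding eval_mpoly_def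
  proof (intro order_trans[OF sum_abs] sum_mono)
    fix m assume m: "m \<in> Poly_Mapping.keys P"
    have "\<bar>\<Prod>i\<in>Poly_Mapping.keys m. x i ^ Poly_Mapping.lookup m i\<bar>
        \<le> (\<Prod>i\<in>Poly_Mapping.keys m. B ^ Poly_Mapping.lookup m i)"
      unfolding abs_prod power_abs
    proof (intro prod_mono conjI power_mono)
      fix i assume "i \<in> Poly_Mapping.keys m"
      then have "i < d" using assms(1) m by (auto simp: in_vars_def)
      then show "\<bar>x i\<bar> \<le> B" by (rule assms(3))
    qed auto
    also have "\<dots> = B ^ k"
      using assms(2)[OF m] by (simp add: monomial_degree_def flip: power_sum)
    finally show "\<bar>of_int (Poly_Mapping.lookup P m) * (\<Prod>i\<in>Poly_Mapping.keys m. x i ^ Poly_Mapping.lookup m i)\<bar>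
        \<le> \<bar>Poly_Mapping.lookup P m\<bar> * B ^ k"
      by (simp add: abs_mult mult_left_mono)
  qed
  then show ?thesis by (simp add: sum_distrib_right)
qed

lemma eval_mpoly_cong:
  assumes "in_vars d P" "\<And>i. i < d \<Longrightarrow> x i = y i"
  shows "eval_mpoly P x = eval_mpoly P y"
  unfolding eval_mpoly_def
proof (intro sum.cong refl arg_cong2[where f = "(*)"] prod.cong)
  fix m i assume "m \<in> Poly_Mapping.keys P" "i \<in> Poly_Mapping.keys m"
  then have "i < d" using assms(1) by (auto simp: in_vars_def)
  then show "x i ^ Poly_Mapping.lookup m i = y i ^ Poly_Mapping.lookup m i"
    using assms(2) by simp
qed

lemma homogeneous_nonconstant_degree:
  assumes "homogeneous_mpoly P" "nonconstant_mpoly P"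
  obtains k where "k \<ge> 1" "\<And>m. m \<in> Poly_Mapping.keys P \<Longrightarrow> monomial_degree m = k"
proof -
  obtain k where k: "\<And>m. m \<in> Poly_Mapping.keys P \<Longrightarrow> monomial_degree m = k"
    using assms(1) by (auto simp: homogeneous_mpoly_def)
  have "k \<noteq> 0"
  proof
    assume "k = 0"
    then have "m = 0" if "m \<in> Poly_Mapping.keys P" for m
      using k[OF that] by (auto simp: monomial_degree_def in_keys_iff intro!: poly_mapping_eqI)
    then have "P = Poly_Mapping.single 0 (Poly_Mapping.lookup P 0)"
      by (intro poly_mapping_eqI) (metis in_keys_iff lookup_single_eq lookup_single_not_eq)
    then show False using assms(2) by (auto simp: nonconstant_mpoly_def)
  qed
  then show ?thesis using that k by (metis One_nat_def Suc_leI neq0_conv)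
qed

section \<open>Averaging over line segments\<close>

text \<open>
  For each fixed \<open>t\<close> with \<open>0 \<le> t < N\<close>, the translation by \<open>- t v\<close> maps the box \<open>[1, N]\<^sup>d\<close> injectively
  into \<open>[1 - V N, N]\<^sup>d\<close>; so the sum over the box is bounded by the sum over the larger box of the
  values at \<open>m + t v\<close>. Adding this up over all \<open>t\<close> gives the claim, without partitioning the box
  into lines. The function \<open>g\<close> lives on all sequences but the translates are extensional on
  \<open>{..<d}\<close>, hence the congruence hypothesis.
\<close>
lemma sum_box_le_sum_lines:
  fixes g :: "(nat \<Rightarrow> int) \<Rightarrow> real" and v :: "nat \<Rightarrow> nat"
  assumes g_nonneg: "\<And>x. g x \<ge> 0"
    and g_cong: "\<And>x y. (\<And>i. i < d \<Longrightarrow> x i = y i) \<Longrightarrow> g x = g y"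
    and v: "\<And>i. i < d \<Longrightarrow> v i \<le> V"
  shows "N * (\<Sum>n\<in>{..<d} \<rightarrow>\<^sub>E {1..N}. g (\<lambda>i. int (n i)))
       \<le> (\<Sum>m\<in>{..<d} \<rightarrow>\<^sub>E {1 - int (V * N)..int N}. \<Sum>t\<in>{0..<int N}. g (\<lambda>i. m i + t * int (v i)))"
proof -
  let ?B = "{..<d} \<rightarrow>\<^sub>E {1..N}" and ?B' = "{..<d} \<rightarrow>\<^sub>E {1 - int (V * N)..int N}"
  have "(\<Sum>n\<in>?B. g (\<lambda>i. int (n i))) \<le> (\<Sum>m\<in>?B'. g (\<lambda>i. m i + t * int (v i)))"
    if t: "t \<in> {0..<int N}" for t
  proof -
    define \<phi> where "\<phi> = (\<lambda>n. restrict (\<lambda>i. int (n i) - t * int (v i)) {..<d})"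
    have "inj_on \<phi> ?B"
    proof (rule inj_onI)
      fix n n' assume n: "n \<in> ?B" "n' \<in> ?B" "\<phi> n = \<phi> n'"
      show "n = n'"
      proof (rule PiE_ext[OF n(1,2)])
        fix i assume "i \<in> {..<d}"
        then show "n i = n' i" using fun_cong[OF n(3), of i] by (simp add: \<phi>_def)
      qed
    qed
    moreover have "\<phi> ` ?B \<subseteq> ?B'"
    proof (rule image_subsetI)
      fix n assume n: "n \<in> ?B"
      show "\<phi> n \<in> ?B'"
      proof (rule PiE_I)
        fix i assume i: "i \<in> {..<d}"
        then have ni: "1 \<le> n i" "n i \<le> N" using n by (auto simp: PiE_def Pi_def)
        have "t * int (v i) \<le> int N * int V" using t v[of i] i by (intro mult_mono) auto
        moreover have "0 \<le> t * int (v i)" using t by simp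
        ultimately show "\<phi> n i \<in> {1 - int (V * N)..int N}"
          using ni i by (auto simp: \<phi>_def mult.commute)
      qed (simp add: \<phi>_def)
    qed
    moreover have "(\<Sum>n\<in>?B. g (\<lambda>i. int (n i))) = (\<Sum>n\<in>?B. g (\<lambda>i. \<phi> n i + t * int (v i)))"
      by (intro sum.cong refl g_cong) (simp add: \<phi>_def)
    ultimately have "(\<Sum>n\<in>?B. g (\<lambda>i. int (n i))) = (\<Sum>m\<in>\<phi> ` ?B. g (\<lambda>i. m i + t * int (v i)))"
      by (simp add: sum.reindex)
    also have "\<dots> \<le> (\<Sum>m\<in>?B'. g (\<lambda>i. m i + t * int (v i)))"
      using \<open>\<phi> ` ?B \<subseteq> ?B'\<close> g_nonneg by (intro sum_mono2) (auto intro: finite_PiE)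
    finally show ?thesis .
  qed
  then have "(\<Sum>t\<in>{0..<int N}. \<Sum>n\<in>?B. g (\<lambda>i. int (n i)))
      \<le> (\<Sum>t\<in>{0..<int N}. \<Sum>m\<in>?B'. g (\<lambda>i. m i + t * int (v i)))"
    by (rule sum_mono)
  then show ?thesis by (subst sum.swap) simp
qed

section \<open>The average number of prime factors of polynomial values\<close>

theorem lemma2:
  fixes d :: nat and P :: int_mpoly
  assumes "in_vars d P"
    and "nonconstant_mpoly P"
    and "homogeneous_mpoly P"
    and "factorwise_regular d P"
  shows "(\<lambda>N::nat. real (\<Sum>n\<in>primitive_tuples d N.
                            big_omega (nat \<bar>eval_mpoly P (\<lambda>i. int (n i))\<bar>)))
           \<in> O(\<lambda>N. real N ^ d * ln (ln (real N)))"
proof -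
  obtain k where k: "k \<ge> 1" "\<And>m. m \<in> Poly_Mapping.keys P \<Longrightarrow> monomial_degree m = k"
    using homogeneous_nonconstant_degree[OF assms(3,2)] by blast
  have "P \<noteq> 0" using assms(2) by (metis nonconstant_mpoly_def single_zero)
  with assms(1) obtain v where v: "eval_mpoly P (\<lambda>i. int (v i)) \<noteq> 0"
    by (rule ex_nonzero_eval_mpoly)
  define V where "V = (\<Sum>i<d. v i)"
  have V: "v i \<le> V" if "i < d" for i
    using that unfolding V_def by (intro member_le_sum) auto
  define W where "W = real (big_omega (nat \<bar>eval_mpoly P (\<lambda>i. int (v i))\<bar>))"
  define H where "H = (\<Sum>m\<in>Poly_Mapping.keys P. \<bar>Poly_Mapping.lookup P m\<bar>)"
  define L where "L = (\<lambda>N::nat. ln (ln (real N)))"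
  define c where "c = 5 / 2 - 2 * ln (ln (2::real))"
  define \<Omega> where "\<Omega> = (\<lambda>n::nat \<Rightarrow> nat. big_omega (nat \<bar>eval_mpoly P (\<lambda>i. int (n i))\<bar>))"
  define C1 where "C1 = 2 * (real k + 1) * (real V + 1) ^ d"
  define C where "C = C1 * (W + 4 * (real k)\<^sup>2 * \<bar>c\<bar>) + (real k + 1) + C1 * (8 * (real k)\<^sup>2)"

  have bound: "real (\<Sum>n\<in>primitive_tuples d N. \<Omega> n) \<le> C * (real N ^ d * L N)"
    if N: "N \<ge> 2" "int N \<ge> H" and LN: "L N \<ge> 1" for N
  proof -
    let ?B = "{..<d} \<rightarrow>\<^sub>E {1..N}" and ?B' = "{..<d} \<rightarrow>\<^sub>E {1 - int (V * N)..int N}"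
    define s where "s = (\<lambda>x. real (small_prime_power_count N (eval_mpoly P x)))"
    define R where "R = (\<Sum>p | prime p \<and> p \<le> N. 1 / real p)"
    define S where "S = (\<Sum>n\<in>?B. s (\<lambda>i. int (n i)))"
    have W0: "W \<ge> 0" by (simp add: W_def)

    have "real N * S \<le> (\<Sum>m\<in>?B'. \<Sum>t\<in>{0..<int N}. s (\<lambda>i. m i + t * int (v i)))"
      unfolding S_def
    proof (rule sum_box_le_sum_lines)
      show "s x = s y" if "\<And>i. i < d \<Longrightarrow> x i = y i" for x y
        using eval_mpoly_cong[OF assms(1), of x y] that by (simp add: s_def)
      show "s x \<ge> 0" for x by (simp add: s_def)
    qed (rule V)
    \<comment> \<open>Every line contributes the same bound, since its top coefficient is the value of \<open>P\<close> at \<open>v\<close>.\<close>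
    also have "\<dots> \<le> (\<Sum>m\<in>?B'. N * (W + 4 * k\<^sup>2 * R))"
    proof (rule sum_mono)
      fix m :: "nat \<Rightarrow> int"
      define f where "f = eval_mpoly P (\<lambda>i. [:m i, int (v i):])"
      have f: "degree f \<le> k" "coeff f k = eval_mpoly P (\<lambda>i. int (v i))"
        "\<And>t. poly f t = eval_mpoly P (\<lambda>i. m i + t * int (v i))"
        unfolding f_def by (rule eval_mpoly_line[OF k(2)]; assumption)+
      have "coeff f k \<noteq> 0" unfolding f(2) by (rule v)
      from sum_small_prime_power_count_le[OF f(1) this k(1), of N]
      show "(\<Sum>t\<in>{0..<int N}. s (\<lambda>i. m i + t * int (v i))) \<le> N * (W + 4 * k\<^sup>2 * R)"
        unfolding f(2,3) s_def W_def R_def .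
    qed
    also have "\<dots> = real N * ((V + 1) ^ d * N ^ d * (W + 4 * k\<^sup>2 * R))"
    proof -
      have "card ?B' = (N + V * N) ^ d"
        by (simp add: card_PiE nat_add_distrib flip: of_nat_mult of_nat_add)
      also have "\<dots> = (V + 1) ^ d * N ^ d" by (simp add: algebra_simps flip: power_mult_distrib)
      finally show ?thesis by simp
    qed
    finally have S: "S \<le> (V + 1) ^ d * N ^ d * (W + 4 * k\<^sup>2 * R)" using N by simp
    have R: "R \<le> \<bar>c\<bar> + 2 * L N"
      using sum_reciprocal_primes_le[of N] N by (simp add: R_def c_def L_def)
    have kR: "(real k)\<^sup>2 * R \<le> (real k)\<^sup>2 * (\<bar>c\<bar> + 2 * L N)"
      by (intro mult_left_mono R) simp

    \<comment> \<open>For \<open>N \<ge> H\<close> the values are at most \<open>H * N ^ k \<le> N ^ (k + 1)\<close>, which accounts for \<open>k + 1\<close>.\<close>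
    have pointwise: "real (\<Omega> n) \<le> 2 * (k + 1) * s (\<lambda>i. int (n i)) + (k + 1)" if "n \<in> ?B" for n
    proof (cases "eval_mpoly P (\<lambda>i. int (n i)) = 0")
      case True
      then show ?thesis by (simp add: \<Omega>_def big_omega_def s_def)
    next
      case False
      define M where "M = nat \<bar>eval_mpoly P (\<lambda>i. int (n i))\<bar>"
      have "int M = \<bar>eval_mpoly P (\<lambda>i. int (n i))\<bar>" by (simp add: M_def)
      also have "\<dots> \<le> H * int N ^ k"
        unfolding H_def
      proof (rule abs_eval_mpoly_le[OF assms(1) k(2)])
        fix i assume "i < d"
        then have "n i \<in> {1..N}" using PiE_mem[OF that, of i] by simp
        then show "\<bar>int (n i)\<bar> \<le> int N" by simp
      qed
      also have "\<dots> \<le> int N * int N ^ k" using N by (intro mult_right_mono) auto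
      also have "\<dots> = int (N ^ (k + 1))" by simp
      finally have "M \<le> N ^ (k + 1)" by (simp only: of_nat_le_iff)
      moreover have "M > 0" using False by (simp add: M_def)
      ultimately have "big_omega M \<le> 2 * (k + 1) * small_prime_power_count N (int M) + (k + 1)"
        using N by (intro big_omega_le) auto
      moreover have "small_prime_power_count N (int M)
          = small_prime_power_count N (eval_mpoly P (\<lambda>i. int (n i)))"
        by (simp add: M_def small_prime_power_count_def)
      ultimately have "\<Omega> n \<le> 2 * (k + 1) * small_prime_power_count N (eval_mpoly P (\<lambda>i. int (n i))) + (k + 1)"
        by (simp add: \<Omega>_def M_def)
      from of_nat_mono[OF this, where 'a = real] show ?thesis by (simp add: s_def algebra_simps)
    qed

    have "primitive_tuples d N \<subseteq> ?B"
      unfolding primitive_tuples_def by (rule Collect_restrict)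
    then have "real (\<Sum>n\<in>primitive_tuples d N. \<Omega> n) \<le> (\<Sum>n\<in>?B. real (\<Omega> n))"
      unfolding of_nat_sum by (intro sum_mono2 finite_PiE) simp_all
    also have "\<dots> \<le> (\<Sum>n\<in>?B. 2 * (k + 1) * s (\<lambda>i. int (n i)) + (k + 1))"
      by (rule sum_mono[OF pointwise])
    also have "\<dots> = 2 * (k + 1) * S + (k + 1) * N ^ d"
      by (simp add: sum.distrib S_def sum_distrib_left card_PiE algebra_simps)
    also have "\<dots> \<le> 2 * (k + 1) * ((V + 1) ^ d * N ^ d * (W + 4 * k\<^sup>2 * (\<bar>c\<bar> + 2 * L N))) + (k + 1) * N ^ d"
      using kR by (intro add_right_mono mult_left_mono order_trans[OF S]) auto
    also have "\<dots> = real N ^ d * (C1 * (W + 4 * (real k)\<^sup>2 * \<bar>c\<bar>) + (real k + 1) + C1 * (8 * (real k)\<^sup>2) * L N)"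
      by (simp add: C1_def algebra_simps)
    also have "\<dots> \<le> real N ^ d * (C * L N)"
    proof (rule mult_left_mono)
      have "0 \<le> C1 * (W + 4 * (real k)\<^sup>2 * \<bar>c\<bar>) + (real k + 1)"
        using W0 by (simp add: C1_def)
      from mult_left_mono[OF LN this]
      show "C1 * (W + 4 * (real k)\<^sup>2 * \<bar>c\<bar>) + (real k + 1) + C1 * (8 * (real k)\<^sup>2) * L N \<le> C * L N"
        by (simp add: C_def distrib_right)
    qed simp
    finally show ?thesis by (simp add: mult_ac)
  qed

  have "eventually (\<lambda>N. L N \<ge> 1) at_top"
    using filterlim_compose[OF ln_at_top filterlim_compose[OF ln_at_top filterlim_real_sequentially]]
    unfolding L_def filterlim_at_top by blast
  moreover have "eventually (\<lambda>N. N \<ge> max 2 (nat H)) at_top" by (rule eventually_ge_at_top)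
  ultimately have "eventually (\<lambda>N. norm (real (\<Sum>n\<in>primitive_tuples d N. \<Omega> n)) \<le> C * norm (real N ^ d * L N)) at_top"
  proof eventually_elim
    case (elim N)
    then have "real (\<Sum>n\<in>primitive_tuples d N. \<Omega> n) \<le> C * (real N ^ d * L N)"
      by (intro bound) auto
    moreover have "norm (real N ^ d * L N) = real N ^ d * L N"
      using elim by (simp add: abs_mult)
    ultimately show ?case by (simp only: real_norm_def abs_of_nat)
  qed
  then show ?thesis unfolding \<Omega>_def L_def by (rule bigoI)
qed

end
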